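(* Let $G=(V,E)$ be a finite graph on $n=|V|$ vertices with maximum degree at most $\Delta$, where $\Delta\ge1$, and let $\mathbf A_G$ be its adjacency matrix. Set $\lambda^\star=-\lambda_{\min}(\mathbf A_G)$, and suppose that $q\ge3$, $0<B<1$, and $\lambda^\star(1-B)B^{1-\Delta}<1$. Put $\delta=1-\lambda^\star(1-B)B^{1-\Delta}$. Then the single-site heat-bath Glauber dynamics $P_{\mathrm{GD}}$ for the $q$-state antiferromagnetic Potts measure $\mu_{G,B}$ has spectral gap $\gamma_{\mathrm{GD}}$ satisfying $$\gamma_{\mathrm{GD}}\;\ge\;\frac{\delta B^\Delta}{q\,n}.$$
   Context: The $q$-state Potts measure on $G$ with parameter $B$ is $\mu_{G,B}(\sigma)\propto B^{m_G(\sigma)}$, $\sigma\in[q]^V$, where $[q]=\{1,\dots,q\}$ and $m_G(\sigma)=|\{vw\in E:\sigma_v=\sigma_w\}|$. For $v\in V$, $c\in[q]$, let $d_c^\sigma(v)$ be the number of neighbours of $v$ with color $c$ under $\sigma$, and let $\sigma^{v\gets c}$ be obtained from $\sigma$ by assigning color $c$ to $v$. The heat-bath Glauber dynamics picks $v\in V$ uniformly at random and moves from $\sigma$ to $\sigma^{v\gets c}$ with probability $B^{d_c^\sigma(v)}/\sum_{a=1}^qB^{d_a^\sigma(v)}$; i.e. $P_{\mathrm{GD}}(\sigma,\sigma^{v\gets c})=\frac1n\frac{B^{d_c^\sigma(v)}}{\sum_{a=1}^qB^{d_a^\sigma(v)}}$ (contributions to staying at $\sigma$ are added over $v$). It is reversible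 with respect to $\mu_{G,B}$. The spectral gap of a reversible kernel $P$ with stationary measure $\mu$ is the largest $\gamma$ such that $\gamma\,\mathrm{Var}_\mu[f]\le\langle f,(I-P)f\rangle_{L^2(\mu)}$ for all $f$. *)

theory Defs
  imports "HOL-Probability.Probability"
begin

text \<open>A graph on the finite vertex type \<open>'v\<close> is given by its set of edges, each edge being
  an unordered pair of distinct vertices.\<close>

definition simple_graph :: "'v::finite set set \<Rightarrow> bool" where
  "simple_graph E \<longleftrightarrow> (\<forall>e\<in>E. card e = 2)"

definition degree :: "'v::finite set set \<Rightarrow> 'v \<Rightarrow> nat" where
  "degree E v = card {w. {v, w} \<in> E}"

definition max_degree :: "'v::finite set set \<Rightarrow> nat" where
  "max_degree E = Max (range (degree E))"

definition adjacency_matrix :: "'v::finite set set \<Rightarrow> real^'v^'v" where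
  "adjacency_matrix E = (\<chi> v w. if {v, w} \<in> E then 1 else 0)"

definition eigenvalues :: "real^'v^'v \<Rightarrow> real set" where
  "eigenvalues A = {l. \<exists>x. x \<noteq> 0 \<and> A *v x = l *\<^sub>R x}"

text \<open>Meant for symmetric matrices, all of whose eigenvalues are real.\<close>

definition min_eigenvalue :: "real^'v^'v \<Rightarrow> real" where
  "min_eigenvalue A = Min (eigenvalues A)"


text \<open>The probability mass function on a finite set \<open>S\<close> that is proportional to the
  weights \<open>w\<close>.\<close>

definition normalized_pmf :: "'a set \<Rightarrow> ('a \<Rightarrow> real) \<Rightarrow> 'a pmf" where
  "normalized_pmf S w = embed_pmf (\<lambda>x. if x \<in> S then w x / sum w S else 0)"

lemma pmf_normalized_pmf:
  assumes "finite S" "\<And>x. x \<in> S \<Longrightarrow> w x \<ge> 0" "sum w S > 0"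
  shows "pmf (normalized_pmf S w) x = (if x \<in> S then w x / sum w S else 0)"
  unfolding normalized_pmf_def
proof (rule pmf_embed_pmf)
  show "0 \<le> (if x \<in> S then w x / sum w S else 0)" for x
    using assms by auto
  have "(\<integral>\<^sup>+x. ennreal (if x \<in> S then w x / sum w S else 0) \<partial>count_space UNIV)
      = (\<Sum>x\<in>S. ennreal (if x \<in> S then w x / sum w S else 0))"
    by (rule nn_integral_count_space') (use assms in auto)
  also have "\<dots> = ennreal (\<Sum>x\<in>S. w x / sum w S)"
    using assms by (subst sum_ennreal[symmetric]) auto
  also have "\<dots> = 1"
    using assms by (simp flip: sum_divide_distrib)
  finally show "(\<integral>\<^sup>+x. ennreal (if x \<in> S then w x / sum w S else 0) \<partial>count_space UNIV) = 1" .
qed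

definition configs :: "nat \<Rightarrow> ('v::finite \<Rightarrow> nat) set" where
  "configs q = (UNIV \<rightarrow>\<^sub>E {1..q})"

definition mono_edges :: "'v::finite set set \<Rightarrow> ('v \<Rightarrow> nat) \<Rightarrow> nat" where
  "mono_edges E \<sigma> = card {e \<in> E. \<exists>v w. e = {v, w} \<and> \<sigma> v = \<sigma> w}"

definition potts :: "'v::finite set set \<Rightarrow> nat \<Rightarrow> real \<Rightarrow> ('v \<Rightarrow> nat) pmf" where
  "potts E q B = normalized_pmf (configs q) (\<lambda>\<sigma>. B ^ mono_edges E \<sigma>)"

definition color_degree :: "'v::finite set set \<Rightarrow> ('v \<Rightarrow> nat) \<Rightarrow> 'v \<Rightarrow> nat \<Rightarrow> nat" where
  "color_degree E \<sigma> v c = card {w. {v, w} \<in> E \<and> \<sigma> w = c}"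

definition glauber :: "'v::finite set set \<Rightarrow> nat \<Rightarrow> real \<Rightarrow> ('v \<Rightarrow> nat) \<Rightarrow> ('v \<Rightarrow> nat) pmf" where
  "glauber E q B \<sigma> = do {
     v \<leftarrow> pmf_of_set UNIV;
     c \<leftarrow> normalized_pmf {1..q} (\<lambda>c. B ^ color_degree E \<sigma> v c);
     return_pmf (\<sigma>(v := c))
   }"

lemma pmf_glauber:
  fixes E :: "'v::finite set set"
  assumes "q \<ge> 1" "B > 0"
  shows "pmf (glauber E q B \<sigma>) \<tau> =
    (\<Sum>v\<in>UNIV. \<Sum>c\<in>{c \<in> {1..q}. \<tau> = \<sigma>(v := c)}.
      1 / real CARD('v) * (B ^ color_degree E \<sigma> v c / (\<Sum>a=1..q. B ^ color_degree E \<sigma> v a)))"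
proof -
  have *: "pmf (normalized_pmf {1..q} (\<lambda>c. B ^ color_degree E \<sigma> v c)) c =
      (if c \<in> {1..q} then B ^ color_degree E \<sigma> v c / (\<Sum>a=1..q. B ^ color_degree E \<sigma> v a) else 0)"
    for v c
    using assms by (intro pmf_normalized_pmf sum_pos) auto
  have "pmf (normalized_pmf {1..q} (\<lambda>c. B ^ color_degree E \<sigma> v c) \<bind> (\<lambda>c. return_pmf (\<sigma>(v := c)))) \<tau>
      = (\<Sum>c\<in>{c \<in> {1..q}. \<tau> = \<sigma>(v := c)}.
          B ^ color_degree E \<sigma> v c / (\<Sum>a=1..q. B ^ color_degree E \<sigma> v a))" for v
  proof -
    have "pmf (normalized_pmf {1..q} (\<lambda>c. B ^ color_degree E \<sigma> v c) \<bind> (\<lambda>c. return_pmf (\<sigma>(v := c)))) \<tau>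
        = (\<Sum>c\<in>{1..q}. pmf (return_pmf (\<sigma>(v := c))) \<tau> *
            pmf (normalized_pmf {1..q} (\<lambda>c. B ^ color_degree E \<sigma> v c)) c)"
      unfolding pmf_bind
      by (subst integral_measure_pmf_real[where A = "{1..q}"]) (auto simp: set_pmf_iff * simp del: One_nat_def split: if_splits)
    also have "\<dots> = (\<Sum>c\<in>{1..q}. if \<tau> = \<sigma>(v := c)
        then B ^ color_degree E \<sigma> v c / (\<Sum>a=1..q. B ^ color_degree E \<sigma> v a) else 0)"
      by (intro sum.cong) (auto simp: * pmf_return simp del: One_nat_def)
    finally show ?thesis
      by (simp only: sum.inter_filter[OF finite_atLeastAtMost])
  qed
  then show ?thesis
    unfolding glauber_def
    by (simp add: pmf_bind_pmf_of_set sum_divide_distrib mult.commute)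
qed


text \<open>Meant for measures \<open>\<mu>\<close> of finite support, for which all expectations exist.\<close>

definition dirichlet_form :: "'a pmf \<Rightarrow> ('a \<Rightarrow> 'a pmf) \<Rightarrow> ('a \<Rightarrow> real) \<Rightarrow> real" where
  "dirichlet_form \<mu> P f =
     measure_pmf.expectation \<mu> (\<lambda>x. f x * (f x - measure_pmf.expectation (P x) f))"

definition spectral_gap :: "'a pmf \<Rightarrow> ('a \<Rightarrow> 'a pmf) \<Rightarrow> real" where
  "spectral_gap \<mu> P =
     (GREATEST \<gamma>. \<forall>f. \<gamma> * measure_pmf.variance \<mu> f \<le> dirichlet_form \<mu> P f)"

end

theory Submission
  imports Defs
begin

text \<open>
  Consider the continuous-time dynamics that recolours \<open>v\<close> with \<open>c\<close> at the unnormalized rate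
  \<open>r\<^sub>v\<^sub>,\<^sub>c(\<sigma>) = B\<^bsup>d\<^sub>c(v)\<^esup>\<close>. It is reversible for the Potts measure, and since
  \<open>\<Sum>\<^sub>a r\<^sub>v\<^sub>,\<^sub>a \<le> q\<close> its Dirichlet form \<open>D\<close> is at most \<open>q n\<close> times that of the heat-bath dynamics.
  A Bochner argument shows \<open>E[(L f)\<^sup>2] \<ge> B\<^bsup>\<Delta>\<^esup> D(f)\<close> for its generator \<open>L\<close>, so that its gap
  is at least \<open>B\<^bsup>\<Delta>\<^esup>\<close>. Expand \<open>(L f)\<^sup>2\<close> over pairs of vertices. For a pair \<open>v \<noteq> w\<close>, removing from
  the sum over pairs of moves the fraction \<open>1 - B\<close> of the moves that give equal colours to
  neighbours leaves a weight that is symmetric under undoing either move, and the remaining sum is a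
  sum of squares of mixed differences. What was removed is the form of \<open>(1 - B) A\<^sub>G\<close> in the
  vectors \<open>(r\<^sub>v\<^sub>,\<^sub>c (f(\<sigma>\<^bsup>v,c\<^esup>) - f(\<sigma>)))\<^sub>v\<close>, which is bounded below by the least eigenvalue of
  \<open>A\<^sub>G\<close>. The diagonal terms pay for this: with \<open>t = \<lambda> (1 - B) \<le> 1\<close>, where \<open>\<lambda>\<close> is minus that
  eigenvalue, a third colour \<open>e\<close> gives
  \<open>\<Sum>\<^sub>a r\<^sub>v\<^sub>,\<^sub>a - t (r\<^sub>v\<^sub>,\<^sub>c + r\<^sub>v\<^sub>,\<^sub>d) \<ge> r\<^sub>v\<^sub>,\<^sub>e \<ge> B\<^bsup>\<Delta>\<^esup>\<close>.
\<close>

subsection \<open>Rayleigh quotients\<close>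

text \<open>First-order condition at a minimum: for small \<open>s\<close> of sign opposite to
  \<open>a\<close> the linear term outweighs the quadratic one.\<close>

lemma quadratic_nonneg_linear_zero:
  fixes a c :: real
  assumes "\<And>s. 2 * s * a + s\<^sup>2 * c \<ge> 0"
  shows "a = 0"
proof (rule ccontr)
  assume "a \<noteq> 0"
  \<comment> \<open>With \<open>C > c\<close> the choice \<open>s = - a / C\<close> yields
    \<open>a\<^sup>2 / C * (c / C - 2)\<close>, which is negative unless
    \<open>a = 0\<close>.\<close>
  define C where "C = \<bar>c\<bar> + 1"
  have C: "C > 0" "c < C" by (auto simp: C_def)
  have "2 * (- a / C) * a + (- a / C)\<^sup>2 * c \<ge> 0" by (rule assms)
  also have "2 * (- a / C) * a + (- a / C)\<^sup>2 * c = a\<^sup>2 / C * (c / C - 2)"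
    using C by (simp add: field_simps power2_eq_square)
  finally have "0 \<le> a\<^sup>2 / C * (c / C - 2)" .
  moreover have "a\<^sup>2 / C > 0" using \<open>a \<noteq> 0\<close> C by simp
  ultimately have "c / C - 2 \<ge> 0" by (metis zero_le_mult_iff not_less)
  then have "c / C \<ge> 2" by simp
  moreover have "c / C < 1" using C by simp
  ultimately show False by simp
qed

text \<open>Tychonoff's theorem, read in the product topology that the function type
  carries.\<close>

lemma compact_function_box:
  fixes A :: "'a \<Rightarrow> real set"
  assumes "\<And>x. compact (A x)"
  shows "compact {f. \<forall>x. f x \<in> A x}"
proof -
  have "compactin (product_topology (\<lambda>_. euclidean) UNIV) (PiE UNIV A)"
    using assms by (simp add: compactin_PiE)
  moreover have "PiE UNIV A = {f. \<forall>x. f x \<in> A x}" by (auto simp: PiE_def)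
  ultimately show ?thesis by (simp add: euclidean_product_topology)
qed

text \<open>The unit sphere of \<open>V\<close> is compact, so the quadratic form attains its
  minimum there; homogeneity extends the bound to all of \<open>V\<close>, and perturbing the
  minimizer gives the Euler-Lagrange equation. The weight \<open>w\<close> and the constraint vector
  \<open>m\<close> allow two uses: the least eigenvalue of a matrix (\<open>m = 0\<close>) and the
  gap on functions of mean zero (\<open>m = 1\<close>).\<close>

lemma rayleigh_minimizer:
  fixes b :: "('a \<Rightarrow> real) \<Rightarrow> ('a \<Rightarrow> real) \<Rightarrow> real" and w m :: "'a \<Rightarrow> real"
  assumes fin: "finite S" and w: "\<And>x. x \<in> S \<Longrightarrow> w x > 0"
    and sym: "\<And>f g. b f g = b g f"
    and lin: "\<And>f g h s. b (\<lambda>x. f x + s * g x) h = b f h + s * b g h"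
    and cont: "continuous_on UNIV (\<lambda>f. b f f)"
  defines "V \<equiv> {f. (\<forall>x. x \<notin> S \<longrightarrow> f x = 0) \<and> (\<Sum>x\<in>S. w x * m x * f x) = 0}"
  assumes g0: "g0 \<in> V" "g0 \<noteq> (\<lambda>_. 0)"
  obtains f where "f \<in> V" "(\<Sum>x\<in>S. w x * (f x)\<^sup>2) = 1"
    "\<And>g. g \<in> V \<Longrightarrow> b f f * (\<Sum>x\<in>S. w x * (g x)\<^sup>2) \<le> b g g"
    "\<And>g. g \<in> V \<Longrightarrow> b f g = b f f * (\<Sum>x\<in>S. w x * f x * g x)"
proof -
  define N where "N f = (\<Sum>x\<in>S. w x * (f x)\<^sup>2)" for f
  \<comment> \<open>\<open>N f = 1\<close> confines each coordinate in \<open>S\<close> to this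
    interval, and \<open>{0}\<close> encodes vanishing off \<open>S\<close>; hence the unit sphere
    of \<open>V\<close> is a closed subset of a compact box.\<close>
  define A where "A x = (if x \<in> S then {- (1 / sqrt (w x)) .. 1 / sqrt (w x)} else {0})" for x
  define K where "K = {f. \<forall>x. f x \<in> A x} \<inter> {f. N f = 1 \<and> (\<Sum>x\<in>S. w x * m x * f x) = 0}"
  have N_nonneg: "N f \<ge> 0" for f
    unfolding N_def by (intro sum_nonneg mult_nonneg_nonneg) (auto dest: w less_imp_le)
  have coord: "continuous_on UNIV (\<lambda>f::'a \<Rightarrow> real. f x)" for x
    by (rule continuous_on_product_coordinates)
  have "closed {f. N f = 1 \<and> (\<Sum>x\<in>S. w x * m x * f x) = 0}"
    unfolding N_def by (intro closed_Collect_conj closed_Collect_eq continuous_intros coord)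
  then have "compact K"
    unfolding K_def by (intro compact_Int_closed compact_function_box) (auto simp: A_def)
  have K_iff: "f \<in> K \<longleftrightarrow> f \<in> V \<and> N f = 1" for f
  proof
    assume "f \<in> K" then show "f \<in> V \<and> N f = 1"
      unfolding K_def V_def A_def by (auto split: if_splits)
  next
    assume f: "f \<in> V \<and> N f = 1"
    have "f x \<in> A x" for x
    proof (cases "x \<in> S")
      case True
      have "w x * (f x)\<^sup>2 \<le> N f"
        unfolding N_def using fin True w
        by (intro member_le_sum) (auto simp: less_imp_le)
      then have "(f x)\<^sup>2 \<le> 1 / w x" using w[OF True] f by (simp add: field_simps)
      then have "\<bar>f x\<bar> \<le> 1 / sqrt (w x)"
        using real_le_rsqrt[of "\<bar>f x\<bar>" "1 / w x"] by (simp add: real_sqrt_divide)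
      then show ?thesis using True by (auto simp: A_def abs_le_iff)
    next
      case False then show ?thesis using f by (auto simp: A_def V_def)
    qed
    then show "f \<in> K" using f unfolding K_def V_def by auto
  qed
  have linr: "b h (\<lambda>x. f x + s * g x) = b h f + s * b h g" for f g h s
    using lin[of f s g h] by (simp add: sym)
  have V_add: "(\<lambda>x. f x + s * g x) \<in> V" if "f \<in> V" "g \<in> V" for f g s
  proof -
    have "(\<Sum>x\<in>S. w x * m x * (f x + s * g x)) = (\<Sum>x\<in>S. w x * m x * f x) + s * (\<Sum>x\<in>S. w x * m x * g x)"
      by (simp add: algebra_simps sum.distrib sum_distrib_left)
    then show ?thesis using that unfolding V_def by simp
  qed
  have b0: "b (\<lambda>_. 0) h = 0" for h using lin[of "\<lambda>_. 0" 1 "\<lambda>_. 0" h] by simp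
  have scale: "b (\<lambda>x. s * g x) h = s * b g h" for s g h
    using lin[of "\<lambda>_. 0" s g h] b0 by simp
  have z0: "(\<lambda>_. 0) \<in> V" by (simp add: V_def)
  have V_scale: "(\<lambda>x. s * g x) \<in> V" if "g \<in> V" for s g
    using V_add[OF z0 that, of s] by simp
  have N_scale: "N (\<lambda>x. s * g x) = s\<^sup>2 * N g" for s g
    unfolding N_def by (simp add: sum_distrib_left power_mult_distrib mult_ac)
  have N_pos: "N g > 0" if g: "g \<in> V" "g \<noteq> (\<lambda>_. 0)" for g
  proof -
    obtain x where x: "g x \<noteq> 0" using g(2) by (auto simp: fun_eq_iff)
    then have "x \<in> S" using g(1) by (auto simp: V_def)
    then have "w x * (g x)\<^sup>2 \<le> N g"
      unfolding N_def using fin w by (intro member_le_sum) (auto simp: less_imp_le)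
    moreover have "w x * (g x)\<^sup>2 > 0" using w[OF \<open>x \<in> S\<close>] x by simp
    ultimately show ?thesis by linarith
  qed
  have normalize: "(\<lambda>x. 1 / sqrt (N g) * g x) \<in> K" if "g \<in> V" "g \<noteq> (\<lambda>_. 0)" for g
    unfolding K_iff N_scale using V_scale[OF that(1), of "1 / sqrt (N g)"] N_pos[OF that]
    by (simp add: power_divide)
  have "K \<noteq> {}" using normalize[OF g0] by auto
  then obtain f where f: "f \<in> K" and min: "\<And>g. g \<in> K \<Longrightarrow> b f f \<le> b g g"
    using continuous_attains_inf[OF \<open>compact K\<close>, of "\<lambda>f. b f f"] continuous_on_subset[OF cont]
    by blast
  have fV: "f \<in> V" and Nf: "N f = 1" using f by (auto simp: K_iff)
  have le: "b f f * N g \<le> b g g" if g: "g \<in> V" for g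
  proof (cases "g = (\<lambda>_. 0)")
    case True then show ?thesis by (simp add: b0 N_def)
  next
    case False
    define s where "s = 1 / sqrt (N g)"
    have "b f f \<le> b (\<lambda>x. s * g x) (\<lambda>x. s * g x)"
      using min[OF normalize[OF g False]] by (simp add: s_def)
    also have "\<dots> = s\<^sup>2 * b g g"
      by (simp add: scale sym[of _ "\<lambda>x. s * g x"] power2_eq_square)
    also have "s\<^sup>2 = 1 / N g" using N_pos[OF g False] by (simp add: s_def power_divide)
    finally show ?thesis using N_pos[OF g False] by (simp add: field_simps)
  qed
  have eq: "b f g = b f f * (\<Sum>x\<in>S. w x * f x * g x)" if g: "g \<in> V" for g
  proof -
    define I where "I = (\<Sum>x\<in>S. w x * f x * g x)"
    \<comment> \<open>This is the inequality \<open>le\<close> at \<open>f + s * g\<close>, expanded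
      in \<open>s\<close>; its constant term cancels because \<open>N f = 1\<close>.\<close>
    have "2 * s * (b f g - b f f * I) + s\<^sup>2 * (b g g - b f f * N g) \<ge> 0" for s
    proof -
      have "N (\<lambda>x. f x + s * g x) = N f + 2 * s * I + s\<^sup>2 * N g"
        unfolding N_def I_def
        by (simp add: power2_eq_square algebra_simps sum.distrib sum_distrib_left)
      moreover have "b (\<lambda>x. f x + s * g x) (\<lambda>x. f x + s * g x) = b f f + 2 * s * b f g + s\<^sup>2 * b g g"
        by (simp add: lin linr sym[of g f] power2_eq_square algebra_simps)
      ultimately show ?thesis
        using le[OF V_add[OF fV g, of s]] Nf by (simp add: algebra_simps)
    qed
    then show ?thesis using quadratic_nonneg_linear_zero unfolding I_def by force
  qed
  show ?thesis
    by (rule that[OF fV Nf[unfolded N_def] le[unfolded N_def] eq])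
qed

text \<open>Eigenvectors of distinct eigenvalues are orthogonal, hence independent. Finiteness gives
  the \<open>Min\<close> in \<open>min_eigenvalue\<close> its meaning.\<close>

lemma finite_eigenvalues_symmetric:
  fixes A :: "real^'n^'n"
  assumes "transpose A = A"
  shows "finite (eigenvalues A)"
proof -
  have "\<exists>x. x \<noteq> 0 \<and> A *v x = l *\<^sub>R x" if "l \<in> eigenvalues A" for l
    using that by (auto simp: eigenvalues_def)
  then obtain e where e: "\<And>l. l \<in> eigenvalues A \<Longrightarrow> e l \<noteq> 0 \<and> A *v e l = l *\<^sub>R e l"
    by metis
  have orth: "e l \<bullet> e k = 0" if "l \<in> eigenvalues A" "k \<in> eigenvalues A" "l \<noteq> k" for l k
  proof -
    have "l * (e l \<bullet> e k) = (A *v e l) \<bullet> e k" using e that by simp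
    also have "\<dots> = e l \<bullet> (A *v e k)"
      using assms dot_lmul_matrix[of "e l" A "e k"] transpose_matrix_vector[of A "e l"] by simp
    also have "\<dots> = k * (e l \<bullet> e k)" using e that by simp
    finally show ?thesis using that by simp
  qed
  have inj: "inj_on e (eigenvalues A)"
    
  proof (rule inj_onI, rule ccontr)
    fix l k assume "l \<in> eigenvalues A" "k \<in> eigenvalues A" "e l = e k" "l \<noteq> k"
    then show False using orth[of l k] e[of k] by simp
  qed
  have "pairwise orthogonal (e ` eigenvalues A)"
    using orth by (auto simp: pairwise_def orthogonal_def)
  then have "independent (e ` eigenvalues A)"
    by (rule pairwise_orthogonal_independent) (use e in force)
  then have "finite (e ` eigenvalues A)" by (rule independent_imp_finite)
  with inj show ?thesis by (simp add: finite_image_iff)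
qed

text \<open>The minimum of the form on the unit sphere is attained at an eigenvector, so this
  minimum is itself an eigenvalue and bounds \<open>min_eigenvalue A\<close> from above.\<close>

lemma min_eigenvalue_le_form:
  fixes A :: "real^'n^'n"
  assumes sym: "\<And>i j. A $ i $ j = A $ j $ i"
  shows "min_eigenvalue A * (\<Sum>i\<in>UNIV. (g i)\<^sup>2) \<le> (\<Sum>i\<in>UNIV. \<Sum>j\<in>UNIV. A $ i $ j * g i * g j)"
proof -
  define b where "b f h = (\<Sum>i\<in>UNIV. \<Sum>j\<in>UNIV. A $ i $ j * f i * h j)" for f h :: "'n \<Rightarrow> real"
  have bsym: "b f h = b h f" for f h
    unfolding b_def by (subst sum.swap) (simp add: sym mult_ac)
  have lin: "b (\<lambda>x. f x + s * g x) h = b f h + s * b g h" for f g h s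
    unfolding b_def by (simp add: algebra_simps sum.distrib sum_distrib_left)
  have cont: "continuous_on UNIV (\<lambda>f. b f f)"
    unfolding b_def by (intro continuous_intros continuous_on_product_coordinates)
  \<comment> \<open>The constraint vector 0 on the full index set makes both conditions
    vacuous.\<close>
  let ?V = "{f::'n \<Rightarrow> real. (\<forall>x. x \<notin> UNIV \<longrightarrow> f x = 0) \<and> (\<Sum>x\<in>UNIV. 1 * 0 * f x) = 0}"
  have V: "g \<in> ?V" for g by simp
  have "(\<lambda>_::'n. 1::real) \<noteq> (\<lambda>_. 0)" by (simp add: fun_eq_iff)
  note minimizer = rayleigh_minimizer[of UNIV "\<lambda>_. 1" b, OF finite zero_less_one bsym lin cont V this]
  obtain f where f: "(\<Sum>x\<in>UNIV. 1 * (f x)\<^sup>2) = 1"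
    and le: "\<And>g. g \<in> ?V \<Longrightarrow> b f f * (\<Sum>x\<in>UNIV. 1 * (g x)\<^sup>2) \<le> b g g"
    and eq: "\<And>g. g \<in> ?V \<Longrightarrow> b f g = b f f * (\<Sum>x\<in>UNIV. 1 * f x * g x)"
    by (rule minimizer) (rule that)
  note le = le[OF V] and eq = eq[OF V]
  have "A *v (\<chi> i. f i) = b f f *\<^sub>R (\<chi> i. f i)"
  proof (intro vec_eq_iff[THEN iffD2] allI)
    fix i
    \<comment> \<open>Testing the Euler-Lagrange equation on the \<open>i\<close>-th coordinate
      vector gives the \<open>i\<close>-th row of the eigenvalue equation.\<close>
    have "b f (\<lambda>j. if j = i then 1 else 0) = (\<Sum>j\<in>UNIV. A $ j $ i * f j)"
      by (simp add: b_def if_distrib cong: if_cong)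
    also have "\<dots> = (A *v (\<chi> i. f i)) $ i"
      by (simp add: matrix_vector_mult_def sym)
    finally show "(A *v (\<chi> i. f i)) $ i = (b f f *\<^sub>R (\<chi> i. f i)) $ i"
      using eq[of "\<lambda>j. if j = i then 1 else 0"] by (simp add: if_distrib cong: if_cong)
  qed
  moreover have "(\<chi> i. f i) \<noteq> 0"
  proof
    assume "(\<chi> i. f i) = 0"
    then have "f i = 0" for i by (metis vec_lambda_beta zero_index)
    then show False using f by simp
  qed
  ultimately have "b f f \<in> eigenvalues A" by (auto simp: eigenvalues_def)
  moreover have "finite (eigenvalues A)"
    by (rule finite_eigenvalues_symmetric) (simp add: transpose_def vec_eq_iff sym)
  ultimately have "min_eigenvalue A \<le> b f f"
    unfolding min_eigenvalue_def by (intro Min_le)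
  then have "min_eigenvalue A * (\<Sum>i\<in>UNIV. (g i)\<^sup>2) \<le> b f f * (\<Sum>i\<in>UNIV. (g i)\<^sup>2)"
    by (intro mult_right_mono sum_nonneg) auto
  also have "\<dots> \<le> b g g" using le[of g] by simp
  finally show ?thesis by (simp add: b_def)
qed

subsection \<open>Finitely supported measures and spectral gaps\<close>

lemma expectation_normalized_pmf:
  fixes g :: "'a \<Rightarrow> real"
  assumes "finite S" "\<And>x. x \<in> S \<Longrightarrow> w x \<ge> 0" "sum w S > 0"
  shows "measure_pmf.expectation (normalized_pmf S w) g = (\<Sum>x\<in>S. w x * g x) / sum w S"
proof -
  note pmf = pmf_normalized_pmf[OF assms]
  have "measure_pmf.expectation (normalized_pmf S w) g = (\<Sum>x\<in>S. g x * pmf (normalized_pmf S w) x)"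
    by (rule integral_measure_pmf_real) (use assms pmf in \<open>auto simp: set_pmf_iff split: if_splits\<close>)
  then show ?thesis by (simp add: pmf sum_divide_distrib mult.commute)
qed

lemma set_normalized_pmf:
  assumes "finite S" "\<And>x. x \<in> S \<Longrightarrow> w x \<ge> 0" "sum w S > 0"
  shows "set_pmf (normalized_pmf S w) \<subseteq> S"
  using pmf_normalized_pmf[OF assms] by (auto simp: set_pmf_iff split: if_splits)

text \<open>\<open>GREATEST\<close> is meaningful only if a greatest element exists. The admissible
  constants form a closed set that contains \<open>\<gamma>\<close> and is bounded by the Rayleigh
  quotient of \<open>h\<close>, so their supremum is admissible.\<close>

lemma spectral_gap_ge:
  fixes h :: "'a \<Rightarrow> real"
  assumes gap: "\<And>f. \<gamma> * measure_pmf.variance \<mu> f \<le> dirichlet_form \<mu> P f"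
    and nontriv: "measure_pmf.variance \<mu> h > 0"
  shows "spectral_gap \<mu> P \<ge> \<gamma>"
proof -
  define Q where "Q g \<longleftrightarrow> (\<forall>f. g * measure_pmf.variance \<mu> f \<le> dirichlet_form \<mu> P f)" for g
  let ?A = "{g. Q g}"
  have ub: "g \<le> dirichlet_form \<mu> P h / measure_pmf.variance \<mu> h" if "Q g" for g
    using that nontriv by (simp add: Q_def pos_le_divide_eq)
  have "\<gamma> \<in> ?A" using gap by (simp add: Q_def)
  moreover have "closed ?A"
    unfolding Q_def by (intro closed_Collect_all closed_Collect_le continuous_intros)
  moreover have bdd: "bdd_above ?A" by (rule bdd_aboveI) (use ub in auto)
  ultimately have "Q (Sup ?A)" using closed_contains_Sup[of ?A] by auto
  then have "(GREATEST g. Q g) = Sup ?A"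
    by (rule Greatest_equality) (simp add: bdd cSup_upper)
  moreover have "\<gamma> \<le> Sup ?A" using \<open>\<gamma> \<in> ?A\<close> bdd by (rule cSup_upper)
  ultimately show ?thesis by (simp add: spectral_gap_def Q_def)
qed

subsection \<open>The unnormalized dynamics\<close>

lemma mem_configs: "\<sigma> \<in> configs q \<longleftrightarrow> (\<forall>v. \<sigma> v \<in> {1..q})"
  by (auto simp: configs_def PiE_def)

lemma finite_configs [simp]: "finite (configs q :: ('v::finite \<Rightarrow> nat) set)"
  unfolding configs_def by (intro finite_PiE) auto

lemma fun_upd_configs: "\<sigma> \<in> configs q \<Longrightarrow> c \<in> {1..q} \<Longrightarrow> \<sigma>(v := c) \<in> configs q"
  by (auto simp: mem_configs)

text \<open>Neighbours of \<open>w\<close> other than \<open>v\<close> keep their colours. The old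
  and new contributions of \<open>v\<close> are added on opposite sides, which avoids truncated
  subtraction.\<close>

lemma color_degree_fun_upd:
  assumes "v \<noteq> w"
  shows "color_degree E (\<sigma>(v := c)) w d + (if {v, w} \<in> E \<and> \<sigma> v = d then 1 else 0)
    = color_degree E \<sigma> w d + (if {v, w} \<in> E \<and> c = d then 1 else 0)"
proof -
  define R where "R = {u. {w, u} \<in> E \<and> u \<noteq> v \<and> \<sigma> u = d}"
  have split: "card (R \<union> (if P then {v} else {})) = card R + (if P then 1 else 0)" for P
    by (auto simp: R_def)
  have "{u. {w, u} \<in> E \<and> (\<sigma>(v := c)) u = d} = R \<union> (if {v, w} \<in> E \<and> c = d then {v} else {})"
    and "{u. {w, u} \<in> E \<and> \<sigma> u = d} = R \<union> (if {v, w} \<in> E \<and> \<sigma> v = d then {v} else {})"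
    using assms by (auto simp: R_def insert_commute split: if_splits)
  then show ?thesis unfolding color_degree_def by (simp only: split)
qed

text \<open>Exchanging a move at \<open>v\<close> with its reverse is an involution on pairs of a
  configuration and a new colour.\<close>

lemma sum_configs_flip:
  fixes H :: "('v::finite \<Rightarrow> nat) \<Rightarrow> nat \<Rightarrow> 'a::comm_monoid_add"
  shows "(\<Sum>\<sigma>\<in>configs q. \<Sum>c=1..q. H \<sigma> c) = (\<Sum>\<sigma>\<in>configs q. \<Sum>c=1..q. H (\<sigma>(v := c)) (\<sigma> v))"
  unfolding sum.cartesian_product
  by (rule sum.reindex_bij_witness[where
        i = "\<lambda>(\<sigma>, c). (\<sigma>(v := c), \<sigma> v)" and j = "\<lambda>(\<sigma>, c). (\<sigma>(v := c), \<sigma> v)"])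
    (auto simp: mem_configs)

locale potts_graph =
  fixes E :: "'v::finite set set" and q :: nat and B :: real
  assumes simple: "simple_graph E" and B_pos: "0 < B"
begin

lemma no_loop [simp]: "{v, v} \<notin> E" "{v} \<notin> E"
  using simple by (force simp: simple_graph_def)+

lemma color_degree_same [simp]: "color_degree E (\<sigma>(v := c)) v d = color_degree E \<sigma> v d"
proof -
  have "{w. {v, w} \<in> E \<and> (\<sigma>(v := c)) w = d} = {w. {v, w} \<in> E \<and> \<sigma> w = d}" by auto
  then show ?thesis by (simp add: color_degree_def)
qed

text \<open>Isolates the dependence on the colour of \<open>v\<close>: monochromatic edges through
  \<open>v\<close> correspond to neighbours sharing its colour, and the other edges do not see that
  colour.\<close>

lemma mono_edges_split:
  "mono_edges E \<sigma> = card {e \<in> E. v \<notin> e \<and> (\<exists>u w. e = {u, w} \<and> \<sigma> u = \<sigma> w)} + color_degree E \<sigma> v (\<sigma> v)"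
proof -
  let ?M = "\<lambda>e. \<exists>u w. e = {u, w} \<and> \<sigma> u = \<sigma> w"
  have fin: "finite (Collect P)" for P :: "'v set \<Rightarrow> bool" by simp
  have "{e \<in> E. ?M e} = {e \<in> E. v \<notin> e \<and> ?M e} \<union> {e \<in> E. v \<in> e \<and> ?M e}" by auto
  then have "mono_edges E \<sigma> = card ({e \<in> E. v \<notin> e \<and> ?M e} \<union> {e \<in> E. v \<in> e \<and> ?M e})"
    by (simp add: mono_edges_def)
  also have "\<dots> = card {e \<in> E. v \<notin> e \<and> ?M e} + card {e \<in> E. v \<in> e \<and> ?M e}"
    by (intro card_Un_disjoint fin) auto
  also have "{e \<in> E. v \<in> e \<and> ?M e} = (\<lambda>w. {v, w}) ` {w. {v, w} \<in> E \<and> \<sigma> w = \<sigma> v}"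
    by (fastforce simp: insert_commute)
  also have "card \<dots> = color_degree E \<sigma> v (\<sigma> v)"
    unfolding color_degree_def by (intro card_image inj_onI) (auto simp: doubleton_eq_iff)
  finally show ?thesis .
qed

section \<open>Generator, Dirichlet form and reversibility\<close>

definition weight :: "('v \<Rightarrow> nat) \<Rightarrow> real" where
  "weight \<sigma> = B ^ mono_edges E \<sigma>"

definition rate :: "'v \<Rightarrow> nat \<Rightarrow> ('v \<Rightarrow> nat) \<Rightarrow> real" where
  "rate v c \<sigma> = B ^ color_degree E \<sigma> v c"

definition grad :: "'v \<Rightarrow> nat \<Rightarrow> (('v \<Rightarrow> nat) \<Rightarrow> real) \<Rightarrow> ('v \<Rightarrow> nat) \<Rightarrow> real" where
  "grad v c f \<sigma> = f (\<sigma>(v := c)) - f \<sigma>"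

definition site_gen :: "'v \<Rightarrow> (('v \<Rightarrow> nat) \<Rightarrow> real) \<Rightarrow> ('v \<Rightarrow> nat) \<Rightarrow> real" where
  "site_gen v f \<sigma> = (\<Sum>c=1..q. rate v c \<sigma> * grad v c f \<sigma>)"

definition gen :: "(('v \<Rightarrow> nat) \<Rightarrow> real) \<Rightarrow> ('v \<Rightarrow> nat) \<Rightarrow> real" where
  "gen f \<sigma> = (\<Sum>v\<in>UNIV. site_gen v f \<sigma>)"

text \<open>The Dirichlet form of \<open>gen\<close>, up to the normalization of
  \<open>weight\<close>. A move and its reverse both occur in the sum, hence the factor 1/2.\<close>

definition energy :: "(('v \<Rightarrow> nat) \<Rightarrow> real) \<Rightarrow> (('v \<Rightarrow> nat) \<Rightarrow> real) \<Rightarrow> real" where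
  "energy f g = (\<Sum>v\<in>UNIV. \<Sum>\<sigma>\<in>configs q. \<Sum>c=1..q.
     weight \<sigma> * rate v c \<sigma> * (grad v c f \<sigma> * grad v c g \<sigma>)) / 2"

lemma weight_pos: "weight \<sigma> > 0" and rate_pos: "rate v c \<sigma> > 0"
  using B_pos by (auto simp: weight_def rate_def)

lemma rate_same [simp]: "rate v d (\<sigma>(v := c)) = rate v d \<sigma>"
  by (simp add: rate_def)

lemma grad_flip: "grad v (\<sigma> v) f (\<sigma>(v := c)) = - grad v c f \<sigma>"
  by (simp add: grad_def)

lemma grad_same [simp]: "grad v (\<sigma> v) f \<sigma> = 0"
  by (simp add: grad_def)

text \<open>Only edges at \<open>v\<close> change status. Rates at \<open>v\<close> ignore the
  colour of \<open>v\<close>, so \<open>rate v (\<sigma> v) \<sigma>\<close> is also the rate of the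
  reverse move at \<open>\<sigma>(v := c)\<close>.\<close>

lemma detailed_balance: "weight (\<sigma>(v := c)) * rate v (\<sigma> v) \<sigma> = weight \<sigma> * rate v c \<sigma>"
proof -
  have "{e \<in> E. v \<notin> e \<and> (\<exists>u w. e = {u, w} \<and> (\<sigma>(v := c)) u = (\<sigma>(v := c)) w)}
      = {e \<in> E. v \<notin> e \<and> (\<exists>u w. e = {u, w} \<and> \<sigma> u = \<sigma> w)}"
    by (intro Collect_cong conj_cong refl ex_cong1) auto
  then have "mono_edges E (\<sigma>(v := c)) + color_degree E \<sigma> v (\<sigma> v) = mono_edges E \<sigma> + color_degree E \<sigma> v c"
    using mono_edges_split[of "\<sigma>(v := c)" v] mono_edges_split[of \<sigma> v] by simp
  then show ?thesis by (simp add: weight_def rate_def flip: power_add)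
qed

lemma sum_flip:
  "(\<Sum>\<sigma>\<in>configs q. \<Sum>c=1..q. weight \<sigma> * rate v c \<sigma> * X \<sigma> c)
   = (\<Sum>\<sigma>\<in>configs q. \<Sum>c=1..q. weight \<sigma> * rate v c \<sigma> * X (\<sigma>(v := c)) (\<sigma> v))"
  by (subst sum_configs_flip[where v = v]) (simp add: detailed_balance)

text \<open>Summation by parts: reversing the move changes the sign of the gradient, so averaging
  the sum with its reversed form leaves half the difference of \<open>Y\<close> along the
  move.\<close>

lemma sum_grad_flip:
  "(\<Sum>\<sigma>\<in>configs q. \<Sum>c=1..q. weight \<sigma> * rate v c \<sigma> * (grad v c f \<sigma> * Y \<sigma> c))
   = (\<Sum>\<sigma>\<in>configs q. \<Sum>c=1..q. weight \<sigma> * rate v c \<sigma> * (grad v c f \<sigma> * (Y \<sigma> c - Y (\<sigma>(v := c)) (\<sigma> v)))) / 2"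
  (is "?L = ?R / 2")
proof -
  have "?L = (\<Sum>\<sigma>\<in>configs q. \<Sum>c=1..q.
      weight \<sigma> * rate v c \<sigma> * (- grad v c f \<sigma> * Y (\<sigma>(v := c)) (\<sigma> v)))"
    by (subst sum_flip) (simp add: grad_flip)
  then have "?L + ?L = ?R"
    by (simp add: right_diff_distrib sum_subtractf sum_negf)
  then show ?thesis by simp
qed

text \<open>Summation by parts with \<open>Y = g\<close>, at each vertex.\<close>

lemma energy_gen:
  "energy g f = - (\<Sum>\<sigma>\<in>configs q. weight \<sigma> * (g \<sigma> * gen f \<sigma>))"
proof -
  have "(\<Sum>\<sigma>\<in>configs q. \<Sum>c=1..q. weight \<sigma> * rate v c \<sigma> * (grad v c f \<sigma> * g \<sigma>))
      = - (\<Sum>\<sigma>\<in>configs q. \<Sum>c=1..q. weight \<sigma> * rate v c \<sigma> * (grad v c g \<sigma> * grad v c f \<sigma>)) / 2" for v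
    by (subst sum_grad_flip) (simp add: grad_def[of _ _ g] sum_negf[symmetric] algebra_simps)
  then have "energy g f = - (\<Sum>v\<in>UNIV. \<Sum>\<sigma>\<in>configs q. \<Sum>c=1..q. weight \<sigma> * rate v c \<sigma> * (grad v c f \<sigma> * g \<sigma>))"
    by (simp add: energy_def sum_negf sum_divide_distrib)
  also have "\<dots> = - (\<Sum>\<sigma>\<in>configs q. weight \<sigma> * (g \<sigma> * gen f \<sigma>))"
    unfolding gen_def site_gen_def
    by (subst sum.swap) (simp add: sum_distrib_left mult_ac)
  finally show ?thesis .
qed

text \<open>Summation by parts with \<open>Y\<close> the site generator itself. As the rates at
  \<open>v\<close> ignore the colour of \<open>v\<close>, its difference along a move at
  \<open>v\<close> is the total rate times the gradient.\<close>

lemma site_gen_square: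
  "(\<Sum>\<sigma>\<in>configs q. weight \<sigma> * (site_gen v f \<sigma>)\<^sup>2)
   = (\<Sum>\<sigma>\<in>configs q. \<Sum>c=1..q.
        weight \<sigma> * rate v c \<sigma> * ((\<Sum>a=1..q. rate v a \<sigma>) * (grad v c f \<sigma>)\<^sup>2)) / 2"
proof -
  have diff: "site_gen v f \<sigma> - site_gen v f (\<sigma>(v := c)) = (\<Sum>a=1..q. rate v a \<sigma>) * grad v c f \<sigma>" for \<sigma> c
    unfolding site_gen_def sum_distrib_right sum_subtractf[symmetric]
    by (intro sum.cong refl) (simp add: grad_def algebra_simps)
  have "(\<Sum>\<sigma>\<in>configs q. weight \<sigma> * (site_gen v f \<sigma>)\<^sup>2)
      = (\<Sum>\<sigma>\<in>configs q. \<Sum>c=1..q. weight \<sigma> * rate v c \<sigma> * (grad v c f \<sigma> * site_gen v f \<sigma>))"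
    by (intro sum.cong refl) (simp add: site_gen_def power2_eq_square sum_distrib_left sum_distrib_right mult_ac)
  also have "\<dots> = (\<Sum>\<sigma>\<in>configs q. \<Sum>c=1..q.
        weight \<sigma> * rate v c \<sigma> * ((\<Sum>a=1..q. rate v a \<sigma>) * (grad v c f \<sigma>)\<^sup>2)) / 2"
    by (subst sum_grad_flip) (simp add: diff power2_eq_square mult_ac)
  finally show ?thesis .
qed

text \<open>The same summation by parts puts this sum, which the eigenvalue bound will cost, in the
  shape of \<open>site_gen_square\<close>, so that coefficients can be compared.\<close>

lemma rate_square_sum:
  "(\<Sum>\<sigma>\<in>configs q. \<Sum>c=1..q. weight \<sigma> * (rate v c \<sigma> * grad v c f \<sigma>)\<^sup>2)
   = (\<Sum>\<sigma>\<in>configs q. \<Sum>c=1..q.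
        weight \<sigma> * rate v c \<sigma> * ((rate v c \<sigma> + rate v (\<sigma> v) \<sigma>) * (grad v c f \<sigma>)\<^sup>2)) / 2"
proof -
  have "(\<Sum>\<sigma>\<in>configs q. \<Sum>c=1..q. weight \<sigma> * (rate v c \<sigma> * grad v c f \<sigma>)\<^sup>2)
    = (\<Sum>\<sigma>\<in>configs q. \<Sum>c=1..q. weight \<sigma> * rate v c \<sigma> * (grad v c f \<sigma> * (rate v c \<sigma> * grad v c f \<sigma>)))"
    by (simp add: power2_eq_square mult_ac)
  also have "\<dots> = (\<Sum>\<sigma>\<in>configs q. \<Sum>c=1..q.
        weight \<sigma> * rate v c \<sigma> * ((rate v c \<sigma> + rate v (\<sigma> v) \<sigma>) * (grad v c f \<sigma>)\<^sup>2)) / 2"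
    by (subst sum_grad_flip) (simp add: grad_flip power2_eq_square algebra_simps)
  finally show ?thesis .
qed

subsection \<open>The Bochner inequality\<close>

definition cross :: "'v \<Rightarrow> 'v \<Rightarrow> nat \<Rightarrow> nat \<Rightarrow> real" where
  "cross v w c d = (if {v, w} \<in> E \<and> c = d then B else 1)"

text \<open>The two \<open>cross\<close> factors record whether \<open>v\<close> counts as a
  neighbour of \<open>w\<close> with colour \<open>d\<close> before and after the move.\<close>

lemma rate_fun_upd:
  assumes "v \<noteq> w"
  shows "rate w d (\<sigma>(v := c)) * cross v w (\<sigma> v) d = rate w d \<sigma> * cross v w c d"
proof -
  have "cross v w a d = B ^ (if {v, w} \<in> E \<and> a = d then 1 else 0)" for a
    by (simp add: cross_def)
  then show ?thesis
    using color_degree_fun_upd[OF assms, of E \<sigma> c d] by (simp only: rate_def flip: power_add)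
qed

text \<open>The factor \<^term>\<open>cross v w c d\<close> makes the weight of a pair of moves at \<open>v\<close> and \<open>w\<close> the same
  at all four corners of the square that they span.\<close>
lemma cross_sum_flip:
  assumes "v \<noteq> w"
  shows "(\<Sum>\<sigma>\<in>configs q. \<Sum>c=1..q. \<Sum>d=1..q.
        weight \<sigma> * rate v c \<sigma> * rate w d \<sigma> * cross v w c d * X \<sigma> c d)
   = (\<Sum>\<sigma>\<in>configs q. \<Sum>c=1..q. \<Sum>d=1..q.
        weight \<sigma> * rate v c \<sigma> * rate w d \<sigma> * cross v w c d * X (\<sigma>(v := c)) (\<sigma> v) d)"
proof -
  have "(\<Sum>\<sigma>\<in>configs q. \<Sum>c=1..q. \<Sum>d=1..q.
        weight \<sigma> * rate v c \<sigma> * rate w d \<sigma> * cross v w c d * X \<sigma> c d)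
    = (\<Sum>\<sigma>\<in>configs q. \<Sum>c=1..q. weight \<sigma> * rate v c \<sigma> *
        (\<Sum>d=1..q. rate w d \<sigma> * cross v w c d * X \<sigma> c d))"
    by (simp add: sum_distrib_left mult_ac)
  also have "\<dots> = (\<Sum>\<sigma>\<in>configs q. \<Sum>c=1..q. weight \<sigma> * rate v c \<sigma> *
        (\<Sum>d=1..q. rate w d \<sigma> * cross v w c d * X (\<sigma>(v := c)) (\<sigma> v) d))"
    by (subst sum_flip) (simp add: rate_fun_upd[OF assms])
  finally show ?thesis by (simp add: sum_distrib_left mult_ac)
qed

lemma cross_commute: "cross v w c d = cross w v d c"
  by (auto simp: cross_def insert_commute)

text \<open>The weight is invariant under reversing the move at \<open>v\<close>, at
  \<open>w\<close>, or both. Averaging the product of gradients over these four versions gives a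
  quarter of the squared mixed difference.\<close>

lemma cross_sum_nonneg:
  assumes "v \<noteq> w"
  shows "(\<Sum>\<sigma>\<in>configs q. \<Sum>c=1..q. \<Sum>d=1..q.
        weight \<sigma> * rate v c \<sigma> * rate w d \<sigma> * cross v w c d * (grad v c f \<sigma> * grad w d f \<sigma>)) \<ge> 0"
proof -
  define S where "S X = (\<Sum>\<sigma>\<in>configs q. \<Sum>c=1..q. \<Sum>d=1..q.
    weight \<sigma> * rate v c \<sigma> * rate w d \<sigma> * cross v w c d * X \<sigma> c d)" for X
  define F where "F \<sigma> c d = f (\<sigma>(v := c, w := d)) - f (\<sigma>(v := c)) - f (\<sigma>(w := d)) + f \<sigma>" for \<sigma> c d
  have flip_v: "S X = S (\<lambda>\<sigma> c d. X (\<sigma>(v := c)) (\<sigma> v) d)" for X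
    unfolding S_def by (rule cross_sum_flip[OF assms])
  have swap: "S X = (\<Sum>\<sigma>\<in>configs q. \<Sum>d=1..q. \<Sum>c=1..q.
    weight \<sigma> * rate w d \<sigma> * rate v c \<sigma> * cross w v d c * X \<sigma> c d)" for X
    unfolding S_def by (subst sum.swap[of _ "{1..q}" "{1..q}"]) (simp add: cross_commute[of v w] mult_ac)
  have flip_w: "S X = S (\<lambda>\<sigma> c d. X (\<sigma>(w := d)) c (\<sigma> w))" for X
    unfolding swap by (rule cross_sum_flip[OF assms[symmetric]])
  have S_add: "S X + S Y = S (\<lambda>\<sigma> c d. X \<sigma> c d + Y \<sigma> c d)" for X Y
    unfolding S_def by (simp add: sum.distrib distrib_left)
  \<comment> \<open>\<open>X1\<close> to \<open>X4\<close> are the product of gradients under no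
    reversal, reversal at \<open>v\<close>, at \<open>w\<close>, and at both; they add up to the
    square of \<open>F\<close>.\<close>
  define X1 where "X1 \<sigma> c d = grad v c f \<sigma> * grad w d f \<sigma>" for \<sigma> c d
  define X2 where "X2 \<sigma> c d = - grad v c f \<sigma> * grad w d f (\<sigma>(v := c))" for \<sigma> c d
  define X3 where "X3 \<sigma> c d = - grad v c f (\<sigma>(w := d)) * grad w d f \<sigma>" for \<sigma> c d
  define X4 where "X4 \<sigma> c d = grad v c f (\<sigma>(w := d)) * grad w d f (\<sigma>(v := c))" for \<sigma> c d
  have upd: "\<sigma>(w := d, v := \<sigma> v) = \<sigma>(w := d)" for \<sigma> :: "'v \<Rightarrow> nat" and d
    using assms by (auto simp: fun_eq_iff)
  have "(\<lambda>\<sigma> c d. X1 (\<sigma>(v := c)) (\<sigma> v) d) = X2" "(\<lambda>\<sigma> c d. X1 (\<sigma>(w := d)) c (\<sigma> w)) = X3"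
    by (intro ext, simp add: X1_def X2_def X3_def grad_flip)+
  then have "S X1 = S X2" "S X1 = S X3"
    using flip_v[of X1] flip_w[of X1] by simp_all
  moreover have "(\<lambda>\<sigma> c d. X3 (\<sigma>(v := c)) (\<sigma> v) d) = X4"
    using assms by (intro ext) (simp add: X3_def X4_def grad_def fun_upd_twist upd algebra_simps)
  then have "S X3 = S X4"
    using flip_v[of X3] by simp
  ultimately have "4 * S X1 = S X1 + S X2 + (S X3 + S X4)" by simp
  also have "\<dots> = S (\<lambda>\<sigma> c d. (F \<sigma> c d)\<^sup>2)"
  proof -
    have "X1 \<sigma> c d + X2 \<sigma> c d + (X3 \<sigma> c d + X4 \<sigma> c d) = (F \<sigma> c d)\<^sup>2" for \<sigma> c d
      using assms
      by (simp add: X1_def X2_def X3_def X4_def F_def grad_def fun_upd_twist power2_eq_square algebra_simps)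
    then show ?thesis by (simp add: S_add)
  qed
  also have "\<dots> \<ge> 0"
    unfolding S_def using B_pos weight_pos rate_pos
    by (intro sum_nonneg mult_nonneg_nonneg) (auto simp: cross_def less_imp_le)
  finally show ?thesis by (simp add: S_def X1_def)
qed

text \<open>Since \<open>cross\<close> is 1 minus \<open>1 - B\<close> on equal colours at adjacent
  vertices, the nonnegative sum splits into the product of site generators minus an adjacency
  term.\<close>

lemma bochner_cross:
  assumes "v \<noteq> w"
  shows "(1 - B) * (\<Sum>\<sigma>\<in>configs q. \<Sum>c=1..q. weight \<sigma> *
      ((if {v, w} \<in> E then 1 else 0) * (rate v c \<sigma> * grad v c f \<sigma>) * (rate w c \<sigma> * grad w c f \<sigma>)))
    \<le> (\<Sum>\<sigma>\<in>configs q. weight \<sigma> * (site_gen v f \<sigma> * site_gen w f \<sigma>))"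
proof -
  let ?u = "\<lambda>v c \<sigma>. rate v c \<sigma> * grad v c f \<sigma>"
  let ?a = "if {v, w} \<in> E then 1 else 0 :: real"
  have "(\<Sum>\<sigma>\<in>configs q. \<Sum>c=1..q. \<Sum>d=1..q.
        weight \<sigma> * rate v c \<sigma> * rate w d \<sigma> * cross v w c d * (grad v c f \<sigma> * grad w d f \<sigma>))
    = (\<Sum>\<sigma>\<in>configs q. \<Sum>c=1..q. \<Sum>d=1..q. weight \<sigma> * (?u v c \<sigma> * ?u w d \<sigma>)
        - (1 - B) * (if c = d then weight \<sigma> * (?a * ?u v c \<sigma> * ?u w d \<sigma>) else 0))"
    by (intro sum.cong refl) (auto simp: cross_def algebra_simps)
  also have "\<dots> = (\<Sum>\<sigma>\<in>configs q. \<Sum>c=1..q. \<Sum>d=1..q. weight \<sigma> * (?u v c \<sigma> * ?u w d \<sigma>))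
        - (1 - B) * (\<Sum>\<sigma>\<in>configs q. \<Sum>c=1..q. weight \<sigma> * (?a * ?u v c \<sigma> * ?u w c \<sigma>))"
  proof -
    have delta: "(\<Sum>d=1..q. if c = d then W d else 0) = W c" if "c \<in> {1..q}" for c and W :: "nat \<Rightarrow> real"
      using that by simp
    show ?thesis
      unfolding sum_subtractf sum_distrib_left[symmetric]
      by (intro arg_cong2[where f = "(-)"] arg_cong2[where f = "(*)"] refl sum.cong delta)
        (auto simp: sum_distrib_left)
  qed
  also have "(\<Sum>\<sigma>\<in>configs q. \<Sum>c=1..q. \<Sum>d=1..q. weight \<sigma> * (?u v c \<sigma> * ?u w d \<sigma>))
     = (\<Sum>\<sigma>\<in>configs q. weight \<sigma> * (site_gen v f \<sigma> * site_gen w f \<sigma>))"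
    by (simp only: site_gen_def sum_product) (simp only: sum_distrib_left)
  finally show ?thesis using cross_sum_nonneg[OF assms, of f] by linarith
qed

section \<open>Bounds on rates and on the adjacency form, and the assembled Bochner
  inequality\<close>

lemma rate_le_1: "B \<le> 1 \<Longrightarrow> rate v c \<sigma> \<le> 1"
  using B_pos by (simp add: rate_def power_le_one)

lemma rate_ge:
  assumes "B \<le> 1" "max_degree E \<le> \<Delta>"
  shows "rate v c \<sigma> \<ge> B ^ \<Delta>"
proof -
  have "color_degree E \<sigma> v c \<le> degree E v"
    unfolding color_degree_def degree_def by (intro card_mono) auto
  also have "\<dots> \<le> max_degree E" by (simp add: max_degree_def)
  finally show ?thesis
    using assms B_pos unfolding rate_def by (intro power_decreasing) auto
qed

lemma energy_nonneg: "energy f f \<ge> 0"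
  unfolding energy_def power2_eq_square[symmetric] using weight_pos rate_pos
  by (intro divide_nonneg_nonneg sum_nonneg mult_nonneg_nonneg) (auto simp: less_imp_le)

lemma energy_commute: "energy f g = energy g f"
  by (simp add: energy_def mult_ac)

lemma energy_cong:
  assumes "\<And>\<sigma>. \<sigma> \<in> configs q \<Longrightarrow> f \<sigma> = g \<sigma>"
  shows "energy f f = energy g g"
  unfolding energy_def grad_def
  by (intro arg_cong2[where f = "(/)"] sum.cong refl) (simp add: assms fun_upd_configs)

lemma adjacency_form_ge:
  "(\<Sum>v\<in>UNIV. \<Sum>w\<in>UNIV. (if {v, w} \<in> E then 1 else 0) * g v * g w)
     \<ge> min_eigenvalue (adjacency_matrix E) * (\<Sum>v\<in>UNIV. (g v)\<^sup>2)"
  using min_eigenvalue_le_form[of "adjacency_matrix E" g]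
  by (simp add: adjacency_matrix_def insert_commute)

text \<open>On a coordinate vector the form is a diagonal entry of the adjacency matrix, which is 0
  without loops.\<close>

lemma min_eigenvalue_adjacency_nonpos: "min_eigenvalue (adjacency_matrix E) \<le> 0"
  using adjacency_form_ge[of "\<lambda>v. if v = undefined then 1 else 0"]
  by (simp add: if_distrib[of "\<lambda>x. x^2"] if_distrib[of "\<lambda>x. _ * x"] cong: if_cong)

text \<open>The place where a third colour enters: as \<open>t \<le> 1\<close>, the rates of
  \<open>c\<close> and \<open>a\<close> cover the subtracted term and the rate of the third colour
  is left over.\<close>

lemma rate_sum_ge:
  assumes q: "q \<ge> 3" and B: "B \<le> 1" and deg: "max_degree E \<le> \<Delta>" and t: "t \<le> 1"
    and c: "c \<in> {1..q}" "a \<in> {1..q}" "c \<noteq> a"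
  shows "B ^ \<Delta> \<le> (\<Sum>c=1..q. rate v c \<sigma>) - t * (rate v c \<sigma> + rate v a \<sigma>)"
proof -
  have "card {c, a} < card {1..q}" using q c by simp
  then have "\<not> {1..q} \<subseteq> {c, a}" by (meson card_mono finite.emptyI finite.insertI not_less)
  then have "\<exists>e\<in>{1..q}. e \<noteq> c \<and> e \<noteq> a" by blast
  then obtain e where e: "e \<in> {1..q}" "e \<noteq> c" "e \<noteq> a" by blast
  have "rate v c \<sigma> + (rate v a \<sigma> + rate v e \<sigma>) = (\<Sum>c\<in>{c, a, e}. rate v c \<sigma>)"
    using c e by simp
  also have "\<dots> \<le> (\<Sum>c=1..q. rate v c \<sigma>)"
    using c e rate_pos by (intro sum_mono2) (auto simp: less_imp_le)
  finally have "rate v c \<sigma> + (rate v a \<sigma> + rate v e \<sigma>) \<le> (\<Sum>c=1..q. rate v c \<sigma>)" .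
  moreover have "t * (rate v c \<sigma> + rate v a \<sigma>) \<le> rate v c \<sigma> + rate v a \<sigma>"
    using mult_right_mono[OF t, of "rate v c \<sigma> + rate v a \<sigma>"] rate_pos[of v c \<sigma>] rate_pos[of v a \<sigma>]
    by simp
  moreover have "rate v e \<sigma> \<ge> B ^ \<Delta>" by (rule rate_ge[OF B deg])
  ultimately show ?thesis by linarith
qed

lemma bochner_inequality:
  assumes q: "q \<ge> 3" and B: "B \<le> 1" and deg: "max_degree E \<le> \<Delta>"
    and t: "- min_eigenvalue (adjacency_matrix E) * (1 - B) \<le> 1"
  shows "B ^ \<Delta> * energy f f \<le> (\<Sum>\<sigma>\<in>configs q. weight \<sigma> * (gen f \<sigma>)\<^sup>2)"
proof -
  define t where "t = - min_eigenvalue (adjacency_matrix E) * (1 - B)"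
  define u where "u v c \<sigma> = rate v c \<sigma> * grad v c f \<sigma>" for v c \<sigma>
  define T where "T v w = (\<Sum>\<sigma>\<in>configs q. weight \<sigma> * (site_gen v f \<sigma> * site_gen w f \<sigma>))" for v w
  define R where "R v = (\<Sum>\<sigma>\<in>configs q. \<Sum>c=1..q. weight \<sigma> * (u v c \<sigma>)\<^sup>2)" for v
  define a where "a v w = (if {v, w} \<in> E then 1 else 0 :: real)" for v w
  \<comment> \<open>The diagonal term pays for \<open>t * R v\<close>: both are sums of the same
    squared gradients, so it suffices to compare coefficients by \<open>rate_sum_ge\<close>. For
    \<open>c = \<sigma> v\<close> the gradient vanishes.\<close>
  have site: "B ^ \<Delta> * (\<Sum>\<sigma>\<in>configs q. \<Sum>c=1..q. weight \<sigma> * rate v c \<sigma> * (grad v c f \<sigma> * grad v c f \<sigma>)) / 2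
      \<le> T v v - t * R v" for v
  proof -
    let ?S = "\<lambda>\<sigma>. \<Sum>a=1..q. rate v a \<sigma>" and ?r = "\<lambda>\<sigma> c. rate v c \<sigma> + rate v (\<sigma> v) \<sigma>"
    have "T v v = (\<Sum>\<sigma>\<in>configs q. \<Sum>c=1..q. weight \<sigma> * rate v c \<sigma> * (?S \<sigma> * (grad v c f \<sigma>)\<^sup>2)) / 2"
      unfolding site_gen_square[of v f, symmetric] T_def by (simp add: power2_eq_square)
    moreover have "R v = (\<Sum>\<sigma>\<in>configs q. \<Sum>c=1..q. weight \<sigma> * rate v c \<sigma> * (?r \<sigma> c * (grad v c f \<sigma>)\<^sup>2)) / 2"
      unfolding rate_square_sum[of v f, symmetric] R_def u_def ..
    moreover have "(\<Sum>\<sigma>\<in>configs q. \<Sum>c=1..q. weight \<sigma> * rate v c \<sigma> * ((?S \<sigma> - t * ?r \<sigma> c) * (grad v c f \<sigma>)\<^sup>2))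
        = (\<Sum>\<sigma>\<in>configs q. \<Sum>c=1..q. weight \<sigma> * rate v c \<sigma> * (?S \<sigma> * (grad v c f \<sigma>)\<^sup>2))
          - t * (\<Sum>\<sigma>\<in>configs q. \<Sum>c=1..q. weight \<sigma> * rate v c \<sigma> * (?r \<sigma> c * (grad v c f \<sigma>)\<^sup>2))"
      unfolding sum_distrib_left[of t] sum_subtractf[symmetric]
      by (intro sum.cong refl) (simp add: algebra_simps)
    ultimately have "T v v - t * R v = (\<Sum>\<sigma>\<in>configs q. \<Sum>c=1..q. weight \<sigma> * rate v c \<sigma> *
        ((?S \<sigma> - t * ?r \<sigma> c) * (grad v c f \<sigma>)\<^sup>2)) / 2"
      by (simp only: diff_divide_distrib times_divide_eq_right)
    moreover have "B ^ \<Delta> * (weight \<sigma> * rate v c \<sigma> * (grad v c f \<sigma> * grad v c f \<sigma>)) \<le> weight \<sigma> * rate v c \<sigma> *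
        (((\<Sum>a=1..q. rate v a \<sigma>) - t * (rate v c \<sigma> + rate v (\<sigma> v) \<sigma>)) * (grad v c f \<sigma>)\<^sup>2)"
      if "\<sigma> \<in> configs q" "c \<in> {1..q}" for \<sigma> c
    proof (cases "c = \<sigma> v")
      case True then show ?thesis by simp
    next
      case False
      have "B ^ \<Delta> \<le> (\<Sum>a=1..q. rate v a \<sigma>) - t * (rate v c \<sigma> + rate v (\<sigma> v) \<sigma>)"
        using that False t by (intro rate_sum_ge[OF q B deg]) (auto simp: mem_configs t_def)
      then have "B ^ \<Delta> * (weight \<sigma> * rate v c \<sigma> * (grad v c f \<sigma>)\<^sup>2) \<le>
          ((\<Sum>a=1..q. rate v a \<sigma>) - t * (rate v c \<sigma> + rate v (\<sigma> v) \<sigma>)) * (weight \<sigma> * rate v c \<sigma> * (grad v c f \<sigma>)\<^sup>2)"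
        using weight_pos[of \<sigma>] rate_pos[of v c \<sigma>] by (intro mult_right_mono) auto
      then show ?thesis by (simp add: power2_eq_square mult_ac)
    qed
    ultimately show ?thesis
      by (simp only: sum_distrib_left divide_right_mono sum_mono zero_le_numeral)
  qed
  \<comment> \<open>One bound for all pairs: on the diagonal \<open>a v v = 0\<close> and equality
    holds, off it this is \<open>bochner_cross\<close>.\<close>
  have cross: "(if w = v then T v v else 0) + (1 - B) * (\<Sum>\<sigma>\<in>configs q. \<Sum>c=1..q. weight \<sigma> * (a v w * u v c \<sigma> * u w c \<sigma>))
      \<le> T v w" for v w
  proof (cases "v = w")
    case True then show ?thesis by (simp add: a_def)
  next
    case False then show ?thesis
      using bochner_cross[OF False, of f] unfolding a_def u_def T_def by simp
  qed
  have "B ^ \<Delta> * energy f f \<le> (\<Sum>v\<in>UNIV. T v v - t * R v)"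
    unfolding energy_def sum_divide_distrib[of _ UNIV] sum_distrib_left[of _ _ UNIV]
    using site by (intro sum_mono) (simp only: times_divide_eq_right)
  also have "\<dots> = (\<Sum>v\<in>UNIV. T v v) + (1 - B) * (\<Sum>\<sigma>\<in>configs q. \<Sum>c=1..q. weight \<sigma> *
      (min_eigenvalue (adjacency_matrix E) * (\<Sum>v\<in>UNIV. (u v c \<sigma>)\<^sup>2)))"
  proof -
    have "(\<Sum>v\<in>UNIV. R v) = (\<Sum>\<sigma>\<in>configs q. \<Sum>c=1..q. weight \<sigma> * (\<Sum>v\<in>UNIV. (u v c \<sigma>)\<^sup>2))"
      unfolding R_def sum_distrib_left
      by (subst sum.swap, intro sum.cong refl, subst sum.swap) simp
    then show ?thesis
      by (simp add: sum_subtractf sum.distrib t_def sum_distrib_left[symmetric] mult.left_commute[of "weight _"])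
  qed
  \<comment> \<open>The eigenvalue bound is applied for each \<open>\<sigma>\<close> and
    \<open>c\<close> separately, to the vector of the \<open>u v c \<sigma>\<close> indexed by
    \<open>v\<close>.\<close>
  also have "\<dots> \<le> (\<Sum>v\<in>UNIV. T v v) + (1 - B) * (\<Sum>\<sigma>\<in>configs q. \<Sum>c=1..q. weight \<sigma> *
      (\<Sum>v\<in>UNIV. \<Sum>w\<in>UNIV. a v w * u v c \<sigma> * u w c \<sigma>))"
    using B weight_pos adjacency_form_ge unfolding a_def
    by (intro add_left_mono mult_left_mono sum_mono) (auto simp: less_imp_le)
  also have "\<dots> = (\<Sum>v\<in>UNIV. \<Sum>w\<in>UNIV. (if w = v then T v v else 0) +
      (1 - B) * (\<Sum>\<sigma>\<in>configs q. \<Sum>c=1..q. weight \<sigma> * (a v w * u v c \<sigma> * u w c \<sigma>)))"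
  proof -
    have "(\<Sum>\<sigma>\<in>configs q. \<Sum>c=1..q. weight \<sigma> * (\<Sum>v\<in>UNIV. \<Sum>w\<in>UNIV. a v w * u v c \<sigma> * u w c \<sigma>))
      = (\<Sum>v\<in>UNIV. \<Sum>\<sigma>\<in>configs q. \<Sum>w\<in>UNIV. \<Sum>c=1..q. weight \<sigma> * (a v w * u v c \<sigma> * u w c \<sigma>))"
      unfolding sum_distrib_left
      by (subst (2) sum.swap, subst sum.swap, intro sum.cong refl, subst sum.swap) simp
    also have "\<dots> = (\<Sum>v\<in>UNIV. \<Sum>w\<in>UNIV. \<Sum>\<sigma>\<in>configs q. \<Sum>c=1..q. weight \<sigma> * (a v w * u v c \<sigma> * u w c \<sigma>))"
      by (intro sum.cong refl sum.swap)
    finally show ?thesis by (simp add: sum.distrib sum_distrib_left)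
  qed
  also have "\<dots> \<le> (\<Sum>v\<in>UNIV. \<Sum>w\<in>UNIV. T v w)"
    by (intro sum_mono cross)
  also have "\<dots> = (\<Sum>\<sigma>\<in>configs q. \<Sum>v\<in>UNIV. \<Sum>w\<in>UNIV. weight \<sigma> * (site_gen v f \<sigma> * site_gen w f \<sigma>))"
    unfolding T_def
    by (subst (2) sum.swap, intro sum.cong refl, subst sum.swap) simp
  also have "\<dots> = (\<Sum>\<sigma>\<in>configs q. weight \<sigma> * (gen f \<sigma>)\<^sup>2)"
    by (simp only: gen_def power2_eq_square sum_product) (simp only: sum_distrib_left)
  finally show ?thesis .
qed

subsection \<open>From Bochner to Poincare\<close>

text \<open>Connectedness of the state space: \<open>\<sigma>\<close> becomes \<open>\<tau>\<close>
  by recolouring one vertex at a time within \<open>configs q\<close>.\<close>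

lemma invariant_imp_constant:
  fixes f :: "('v \<Rightarrow> nat) \<Rightarrow> real"
  assumes f: "\<And>\<sigma> v c. \<sigma> \<in> configs q \<Longrightarrow> c \<in> {1..q} \<Longrightarrow> f (\<sigma>(v := c)) = f \<sigma>"
    and "\<sigma> \<in> configs q" "\<tau> \<in> configs q"
  shows "f \<sigma> = f \<tau>"
proof -
  have "f (\<lambda>v. if v \<in> D then \<tau> v else \<sigma> v) = f \<sigma>" if "finite D" for D
    using that
  proof induction
    case (insert x D)
    let ?\<rho> = "\<lambda>v. if v \<in> D then \<tau> v else \<sigma> v"
    have "(\<lambda>v. if v \<in> insert x D then \<tau> v else \<sigma> v) = ?\<rho>(x := \<tau> x)" by auto
    moreover have "?\<rho> \<in> configs q" "\<tau> x \<in> {1..q}" using assms by (auto simp: mem_configs)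
    ultimately show ?case using f insert.IH by metis
  qed simp
  from this[of UNIV] show ?thesis by simp
qed

lemma energy_zero_imp_constant:
  assumes "energy f f = 0" "\<sigma> \<in> configs q" "\<tau> \<in> configs q"
  shows "f \<sigma> = f \<tau>"
proof (rule invariant_imp_constant)
  fix \<sigma> :: "'v \<Rightarrow> nat" and v c assume \<sigma>: "\<sigma> \<in> configs q" "c \<in> {1..q}"
  have term_nonneg: "0 \<le> weight \<sigma> * rate v c \<sigma> * (grad v c f \<sigma> * grad v c f \<sigma>)" for \<sigma> v c
    using weight_pos[of \<sigma>] rate_pos[of v c \<sigma>] by (intro mult_nonneg_nonneg[OF _ zero_le_square]) simp
  have "(\<Sum>v\<in>UNIV. \<Sum>\<sigma>\<in>configs q. \<Sum>c=1..q. weight \<sigma> * rate v c \<sigma> * (grad v c f \<sigma> * grad v c f \<sigma>)) = 0"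
    using assms(1) by (simp only: energy_def divide_eq_0_iff) simp
  then have "weight \<sigma> * rate v c \<sigma> * (grad v c f \<sigma> * grad v c f \<sigma>) = 0"
    using \<sigma> term_nonneg by (simp only: sum_nonneg_eq_0_iff sum_nonneg finite_class.finite_UNIV
        finite_configs finite_atLeastAtMost) blast
  then show "f (\<sigma>(v := c)) = f \<sigma>"
    using weight_pos[of \<sigma>] rate_pos[of v c \<sigma>] by (simp add: grad_def)
qed (use assms in auto)

lemma grad_linear: "grad v c (\<lambda>x. f x + s * g x) \<sigma> = grad v c f \<sigma> + s * grad v c g \<sigma>"
  by (simp add: grad_def algebra_simps)

text \<open>The minimizer \<open>f\<close> of the Rayleigh quotient on mean-zero functions is a weak
  eigenfunction of \<open>gen\<close>. Testing its equation on \<open>gen f\<close> turns the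
  Bochner sum into \<open>energy f f * energy f f\<close>, whence
  \<open>\<gamma> \<le> energy f f\<close>, the minimal quotient.\<close>

lemma poincare_of_bochner:
  assumes bochner: "\<And>f. \<gamma> * energy f f \<le> (\<Sum>\<sigma>\<in>configs q. weight \<sigma> * (gen f \<sigma>)\<^sup>2)"
    and mean: "(\<Sum>\<sigma>\<in>configs q. weight \<sigma> * g \<sigma>) = 0"
  shows "\<gamma> * (\<Sum>\<sigma>\<in>configs q. weight \<sigma> * (g \<sigma>)\<^sup>2) \<le> energy g g"
proof -
  \<comment> \<open>The type of colourings is infinite; cutting functions off outside
    \<open>configs q\<close> puts them in the finite-dimensional space of
    \<open>rayleigh_minimizer\<close> without changing energies.\<close>
  define restr where "restr f \<sigma> = (if \<sigma> \<in> configs q then f \<sigma> else 0)" for f :: "('v \<Rightarrow> nat) \<Rightarrow> real" and \<sigma>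
  have energy_restr: "energy g g = energy (restr g) (restr g)"
    by (rule energy_cong) (simp add: restr_def)
  let ?V = "{f. (\<forall>\<sigma>. \<sigma> \<notin> configs q \<longrightarrow> f \<sigma> = 0) \<and> (\<Sum>\<sigma>\<in>configs q. weight \<sigma> * 1 * f \<sigma>) = 0}"
  have gV: "restr g \<in> ?V" using mean by (simp add: restr_def)
  show ?thesis
  proof (cases "restr g = (\<lambda>_. 0)")
    case True
    then have "g \<sigma> = 0" if "\<sigma> \<in> configs q" for \<sigma>
      using that by (auto simp: restr_def fun_eq_iff split: if_splits)
    then show ?thesis by (simp add: energy_nonneg)
  next
    case False
    have lin: "energy (\<lambda>x. f x + s * g x) h = energy f h + s * energy g h" for f g h s
      unfolding energy_def grad_linear
      by (simp add: algebra_simps sum.distrib sum_distrib_left add_divide_distrib)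
    have cont: "continuous_on UNIV (\<lambda>f. energy f f)"
      unfolding energy_def grad_def by (intro continuous_intros continuous_on_product_coordinates) auto
    obtain f where fV: "f \<in> ?V" and norm: "(\<Sum>\<sigma>\<in>configs q. weight \<sigma> * (f \<sigma>)\<^sup>2) = 1"
      and le: "\<And>g. g \<in> ?V \<Longrightarrow> energy f f * (\<Sum>\<sigma>\<in>configs q. weight \<sigma> * (g \<sigma>)\<^sup>2) \<le> energy g g"
      and eq: "\<And>g. g \<in> ?V \<Longrightarrow> energy f g = energy f f * (\<Sum>\<sigma>\<in>configs q. weight \<sigma> * f \<sigma> * g \<sigma>)"
      by (rule rayleigh_minimizer[OF finite_configs weight_pos energy_commute lin cont gV False]) (rule that)
    \<comment> \<open>Pairing with constants shows that \<open>gen f\<close> has mean zero, so it is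
      an admissible test function.\<close>
    have "energy (\<lambda>_. 1) f = 0" by (simp add: energy_def grad_def)
    then have hV: "restr (gen f) \<in> ?V" by (simp add: energy_gen restr_def)
    have "- (\<Sum>\<sigma>\<in>configs q. weight \<sigma> * (gen f \<sigma>)\<^sup>2) = energy (restr (gen f)) f"
      by (simp add: energy_gen restr_def power2_eq_square)
    also have "\<dots> = energy f f * (\<Sum>\<sigma>\<in>configs q. weight \<sigma> * f \<sigma> * restr (gen f) \<sigma>)"
      by (subst energy_commute) (rule eq[OF hV])
    also have "(\<Sum>\<sigma>\<in>configs q. weight \<sigma> * f \<sigma> * restr (gen f) \<sigma>) = - energy f f"
      by (simp add: energy_gen[of f f] restr_def mult_ac)
    finally have "\<gamma> * energy f f \<le> energy f f * energy f f"
      using bochner[of f] by simp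
    \<comment> \<open>Needed for cancelling: zero energy would make \<open>f\<close> constant, and
      with mean zero this contradicts its unit norm.\<close>
    moreover have "energy f f \<noteq> 0"
    proof
      assume "energy f f = 0"
      then have const: "f \<sigma> = f \<tau>" if "\<sigma> \<in> configs q" "\<tau> \<in> configs q" for \<sigma> \<tau>
        using that by (rule energy_zero_imp_constant)
      have "(\<Sum>\<sigma>\<in>configs q. weight \<sigma> * (f \<sigma>)\<^sup>2) = 0"
      proof (cases "configs q = ({} :: ('v \<Rightarrow> nat) set)")
        case False
        then obtain \<tau> :: "'v \<Rightarrow> nat" where \<tau>: "\<tau> \<in> configs q" by blast
        have "(\<Sum>\<sigma>\<in>configs q. weight \<sigma> * (f \<sigma>)\<^sup>2) = f \<tau> * (\<Sum>\<sigma>\<in>configs q. weight \<sigma> * 1 * f \<sigma>)"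
          unfolding sum_distrib_left
          by (intro sum.cong refl) (simp add: const[OF _ \<tau>] power2_eq_square)
        then show ?thesis using fV by simp
      qed simp
      with norm show False by simp
    qed
    ultimately have "\<gamma> \<le> energy f f" using energy_nonneg[of f] by simp
    then have "\<gamma> * (\<Sum>\<sigma>\<in>configs q. weight \<sigma> * (restr g \<sigma>)\<^sup>2)
        \<le> energy f f * (\<Sum>\<sigma>\<in>configs q. weight \<sigma> * (restr g \<sigma>)\<^sup>2)"
      using weight_pos by (intro mult_right_mono sum_nonneg mult_nonneg_nonneg) (auto simp: less_imp_le)
    also have "\<dots> \<le> energy (restr g) (restr g)" by (rule le[OF gV])
    finally show ?thesis by (simp add: energy_restr restr_def)
  qed
qed

subsection \<open>Comparison with the heat-bath dynamics\<close>

context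
  assumes q: "q \<ge> 1"
begin

lemma rate_sum_pos: "(\<Sum>a=1..q. rate v a \<sigma>) > 0"
  using q rate_pos by (intro sum_pos) auto

definition partition_fun :: real where
  "partition_fun = (\<Sum>\<sigma>\<in>configs q. weight \<sigma>)"

lemma partition_fun_pos: "partition_fun > 0"
proof -
  have "(\<lambda>_. 1) \<in> (configs q :: ('v \<Rightarrow> nat) set)" using q by (simp add: mem_configs)
  then show ?thesis unfolding partition_fun_def using weight_pos by (intro sum_pos) auto
qed

lemma expectation_potts:
  "measure_pmf.expectation (potts E q B) g = (\<Sum>\<sigma>\<in>configs q. weight \<sigma> * g \<sigma>) / partition_fun"
  unfolding potts_def weight_def[symmetric] partition_fun_def
  by (rule expectation_normalized_pmf) (use weight_pos partition_fun_pos in \<open>auto simp: partition_fun_def less_imp_le\<close>)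

lemma expectation_glauber:
  fixes f :: "('v \<Rightarrow> nat) \<Rightarrow> real"
  shows "measure_pmf.expectation (glauber E q B \<sigma>) f =
    (\<Sum>v\<in>UNIV. (\<Sum>c=1..q. rate v c \<sigma> * f (\<sigma>(v := c))) / (\<Sum>a=1..q. rate v a \<sigma>)) / CARD('v)"
proof -
  define N where "N v = normalized_pmf {1..q} (\<lambda>c. rate v c \<sigma>)" for v
  have N: "set_pmf (N v) \<subseteq> {1..q}" for v
    unfolding N_def by (rule set_normalized_pmf) (use rate_pos rate_sum_pos in \<open>auto simp: less_imp_le\<close>)
  have "measure_pmf.expectation (N v \<bind> (\<lambda>c. return_pmf (\<sigma>(v := c)))) f
      = (\<Sum>c=1..q. rate v c \<sigma> * f (\<sigma>(v := c))) / (\<Sum>a=1..q. rate v a \<sigma>)" for v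
  proof -
    have "measure_pmf.expectation (N v \<bind> (\<lambda>c. return_pmf (\<sigma>(v := c)))) f
        = measure_pmf.expectation (N v) (\<lambda>c. f (\<sigma>(v := c)))"
      unfolding map_pmf_def[symmetric] by simp
    also have "\<dots> = (\<Sum>c=1..q. rate v c \<sigma> * f (\<sigma>(v := c))) / (\<Sum>a=1..q. rate v a \<sigma>)"
      unfolding N_def
      by (rule expectation_normalized_pmf) (use rate_pos rate_sum_pos in \<open>auto simp: less_imp_le\<close>)
    finally show ?thesis .
  qed
  moreover have "finite (set_pmf (N v \<bind> (\<lambda>c. return_pmf (\<sigma>(v := c)))))" for v
    using finite_subset[OF N] by simp
  ultimately show ?thesis
    unfolding glauber_def rate_def[symmetric] N_def[symmetric]
    by (subst pmf_expectation_bind_pmf_of_set) (auto simp: divide_inverse mult.commute sum_distrib_left)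
qed

text \<open>The heat bath divides the rates at \<open>v\<close> by their sum, which is at most
  \<open>q\<close>, and by the number of vertices.\<close>

lemma dirichlet_form_glauber_ge:
  assumes B: "B \<le> 1"
  shows "dirichlet_form (potts E q B) (glauber E q B) f \<ge> energy f f / (real q * real CARD('v)) / partition_fun"
proof -
  let ?S = "\<lambda>v \<sigma>. \<Sum>a=1..q. rate v a \<sigma>"
  have drift: "f \<sigma> - measure_pmf.expectation (glauber E q B \<sigma>) f
      = - (\<Sum>v\<in>UNIV. \<Sum>c=1..q. rate v c \<sigma> * grad v c f \<sigma> / ?S v \<sigma>) / CARD('v)" for \<sigma>
  proof -
    have "(\<Sum>c=1..q. rate v c \<sigma> * grad v c f \<sigma> / ?S v \<sigma>)
        = (\<Sum>c=1..q. rate v c \<sigma> * f (\<sigma>(v := c))) / ?S v \<sigma> - f \<sigma>" for v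
    proof -
      have "(\<Sum>c=1..q. rate v c \<sigma> * grad v c f \<sigma>) = (\<Sum>c=1..q. rate v c \<sigma> * f (\<sigma>(v := c))) - ?S v \<sigma> * f \<sigma>"
        unfolding sum_distrib_right sum_subtractf[symmetric] by (simp add: grad_def right_diff_distrib)
      then show ?thesis
        using rate_sum_pos[of v \<sigma>] unfolding sum_divide_distrib[symmetric] by (simp add: diff_divide_distrib)
    qed
    then show ?thesis
      by (simp add: expectation_glauber sum_subtractf diff_divide_distrib)
  qed
  \<comment> \<open>Summation by parts survives the division, because the total rate at
    \<open>v\<close> is unchanged by a move at \<open>v\<close>.\<close>
  have site: "- (\<Sum>\<sigma>\<in>configs q. \<Sum>c=1..q. weight \<sigma> * rate v c \<sigma> * (grad v c f \<sigma> * (f \<sigma> / ?S v \<sigma>)))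
      = (\<Sum>\<sigma>\<in>configs q. \<Sum>c=1..q. weight \<sigma> * rate v c \<sigma> * (grad v c f \<sigma> * grad v c f \<sigma>) / ?S v \<sigma>) / 2" for v
  proof -
    have "f \<sigma> / ?S v \<sigma> - f (\<sigma>(v := c)) / ?S v \<sigma> = - (grad v c f \<sigma> / ?S v \<sigma>)" for \<sigma> c
      by (simp add: grad_def diff_divide_distrib)
    then show ?thesis by (subst sum_grad_flip) (simp add: sum_negf)
  qed
  have "energy f f / q = (\<Sum>v\<in>UNIV. (\<Sum>\<sigma>\<in>configs q. \<Sum>c=1..q.
      weight \<sigma> * rate v c \<sigma> * (grad v c f \<sigma> * grad v c f \<sigma>) / q) / 2)"
    unfolding energy_def by (simp add: sum_divide_distrib[symmetric])
  also have "\<dots> \<le> (\<Sum>v\<in>UNIV. (\<Sum>\<sigma>\<in>configs q. \<Sum>c=1..q.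
      weight \<sigma> * rate v c \<sigma> * (grad v c f \<sigma> * grad v c f \<sigma>) / ?S v \<sigma>) / 2)"
  proof (intro sum_mono divide_right_mono divide_left_mono)
    fix v \<sigma> c
    show "?S v \<sigma> \<le> q" using sum_mono[of "{1..q}" "\<lambda>a. rate v a \<sigma>" "\<lambda>_. 1"] rate_le_1[OF B] by simp
    show "0 \<le> weight \<sigma> * rate v c \<sigma> * (grad v c f \<sigma> * grad v c f \<sigma>)"
      using weight_pos[of \<sigma>] rate_pos[of v c \<sigma>] by (intro mult_nonneg_nonneg[OF _ zero_le_square]) simp
    show "0 < real q * ?S v \<sigma>" using q rate_sum_pos by simp
  qed simp
  also have "\<dots> = - (\<Sum>v\<in>UNIV. \<Sum>\<sigma>\<in>configs q. \<Sum>c=1..q.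
      weight \<sigma> * rate v c \<sigma> * (grad v c f \<sigma> * (f \<sigma> / ?S v \<sigma>)))"
    by (simp only: site[symmetric] sum_negf)
  also have "\<dots> = (\<Sum>\<sigma>\<in>configs q. weight \<sigma> * (f \<sigma> * - (\<Sum>v\<in>UNIV. \<Sum>c=1..q. rate v c \<sigma> * grad v c f \<sigma> / ?S v \<sigma>)))"
    by (subst sum.swap) (simp add: sum_distrib_left sum_negf mult_ac)
  also have "\<dots> = (\<Sum>\<sigma>\<in>configs q. weight \<sigma> * (f \<sigma> * (f \<sigma> - measure_pmf.expectation (glauber E q B \<sigma>) f))) * CARD('v)"
    unfolding drift sum_distrib_right by (intro sum.cong refl) simp
  also have "\<dots> = dirichlet_form (potts E q B) (glauber E q B) f * partition_fun * CARD('v)"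
    unfolding dirichlet_form_def expectation_potts using partition_fun_pos by simp
  finally show ?thesis using partition_fun_pos q by (simp add: field_simps)
qed

lemma variance_potts:
  "measure_pmf.variance (potts E q B) f =
     (\<Sum>\<sigma>\<in>configs q. weight \<sigma> * (f \<sigma> - measure_pmf.expectation (potts E q B) f)\<^sup>2) / partition_fun"
  by (rule expectation_potts)

text \<open>Subtracting the mean leaves the energy unchanged and turns the variance into a weighted
  sum of squares, so the mean-zero inequality applies.\<close>

lemma glauber_poincare:
  assumes "B \<le> 1"
    and bochner: "\<And>f. \<gamma> * energy f f \<le> (\<Sum>\<sigma>\<in>configs q. weight \<sigma> * (gen f \<sigma>)\<^sup>2)"
  shows "\<gamma> / (real q * real CARD('v)) * measure_pmf.variance (potts E q B) f
    \<le> dirichlet_form (potts E q B) (glauber E q B) f"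
proof -
  define g where "g \<sigma> = f \<sigma> - measure_pmf.expectation (potts E q B) f" for \<sigma>
  have "(\<Sum>\<sigma>\<in>configs q. weight \<sigma> * g \<sigma>)
      = (\<Sum>\<sigma>\<in>configs q. weight \<sigma> * f \<sigma>) - partition_fun * measure_pmf.expectation (potts E q B) f"
    by (simp add: g_def right_diff_distrib sum_subtractf partition_fun_def sum_distrib_right)
  also have "\<dots> = 0" using partition_fun_pos by (simp add: expectation_potts)
  finally have "\<gamma> * (\<Sum>\<sigma>\<in>configs q. weight \<sigma> * (g \<sigma>)\<^sup>2) \<le> energy g g"
    by (rule poincare_of_bochner[OF bochner])
  also have "energy g g = energy f f" by (simp add: energy_def grad_def g_def)
  finally have "\<gamma> * (\<Sum>\<sigma>\<in>configs q. weight \<sigma> * (g \<sigma>)\<^sup>2) / partition_fun \<le> energy f f / partition_fun"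
    using partition_fun_pos by (simp add: divide_right_mono)
  then have "\<gamma> * measure_pmf.variance (potts E q B) f \<le> energy f f / partition_fun"
    by (simp only: variance_potts g_def times_divide_eq_right)
  then have "\<gamma> * measure_pmf.variance (potts E q B) f / (real q * real CARD('v))
      \<le> energy f f / partition_fun / (real q * real CARD('v))"
    by (intro divide_right_mono) auto
  also have "\<dots> \<le> dirichlet_form (potts E q B) (glauber E q B) f"
    using dirichlet_form_glauber_ge[OF assms(1), of f] by (simp add: mult_ac)
  finally show ?thesis by simp
qed

end

section \<open>Nonconstant observables and the final bound\<close>

lemma potts_nontrivial:
  assumes "q \<ge> 2"
  shows "\<exists>f :: ('v \<Rightarrow> nat) \<Rightarrow> real. measure_pmf.variance (potts E q B) f > 0"
proof -
  \<comment> \<open>The colour of one arbitrary vertex. It attains both 1 and 2, so it differs from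
    its mean at some configuration, which has positive weight.\<close>
  define f :: "('v \<Rightarrow> nat) \<Rightarrow> real" where "f = (\<lambda>\<sigma>. real (\<sigma> undefined))"
  define m where "m = measure_pmf.expectation (potts E q B) f"
  have q: "q \<ge> 1" using assms by simp
  obtain \<sigma> :: "'v \<Rightarrow> nat" where \<sigma>: "\<sigma> \<in> configs q" "f \<sigma> \<noteq> m"
  proof (cases "m = 1")
    case True
    then show ?thesis using assms that[of "\<lambda>_. 2"] by (simp add: mem_configs f_def)
  next
    case False
    then show ?thesis using q that[of "\<lambda>_. 1"] by (simp add: mem_configs f_def)
  qed
  have "(\<Sum>\<sigma>\<in>configs q. weight \<sigma> * (f \<sigma> - m)\<^sup>2) > 0"
    using \<sigma> weight_pos by (intro sum_pos2[of _ \<sigma>]) (auto simp: less_imp_le)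
  then have "measure_pmf.variance (potts E q B) f > 0"
    unfolding m_def variance_potts[OF q] using partition_fun_pos[OF q] by (rule divide_pos_pos)
  then show ?thesis by blast
qed

end

theorem corollary6p7:
  fixes E :: "'v::finite set set"
    and \<Delta> q :: nat
    and B lam \<delta> :: real
  assumes "simple_graph E"
    and "\<Delta> \<ge> 1"
    and "max_degree E \<le> \<Delta>"
    and "lam = - min_eigenvalue (adjacency_matrix E)"
    and "q \<ge> 3"
    and "0 < B" and "B < 1"
    and "lam * (1 - B) * B powi (1 - int \<Delta>) < 1"
    and "\<delta> = 1 - lam * (1 - B) * B powi (1 - int \<Delta>)"
  shows "spectral_gap (potts E q B) (glauber E q B) \<ge> \<delta> * B ^ \<Delta> / (real q * real CARD('v))"
proof -
  interpret potts_graph E q B by unfold_locales fact+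
  have lam: "0 \<le> lam * (1 - B)"
    using min_eigenvalue_adjacency_nonpos assms by (intro mult_nonneg_nonneg) auto
  \<comment> \<open>As \<open>\<Delta> \<ge> 1\<close>, the exponent is at most 0. Hence
    \<open>lam * (1 - B)\<close> is bounded by the quantity assumed below 1, as the Bochner
    inequality requires.\<close>
  have powi: "B powi (1 - int \<Delta>) \<ge> 1"
  proof -
    have "B powi (1 - int \<Delta>) = 1 / B ^ (\<Delta> - 1)"
      using assms by (simp add: power_int_def nat_diff_distrib divide_inverse power_inverse)
    then show ?thesis using assms by (simp add: power_le_one)
  qed
  have "lam * (1 - B) * 1 \<le> lam * (1 - B) * B powi (1 - int \<Delta>)"
    by (rule mult_left_mono[OF powi lam])
  then have t: "lam * (1 - B) \<le> 1" and \<delta>: "\<delta> \<le> 1" using assms lam by auto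
  have bochner: "B ^ \<Delta> * energy f f \<le> (\<Sum>\<sigma>\<in>configs q. weight \<sigma> * (gen f \<sigma>)\<^sup>2)" for f
    by (rule bochner_inequality) (use assms t in auto)
  obtain h :: "('v \<Rightarrow> nat) \<Rightarrow> real" where "measure_pmf.variance (potts E q B) h > 0"
    using potts_nontrivial assms by auto
  then have "B ^ \<Delta> / (real q * real CARD('v)) \<le> spectral_gap (potts E q B) (glauber E q B)"
    by (intro spectral_gap_ge glauber_poincare) (use assms bochner in auto)
  \<comment> \<open>Since \<open>\<delta> \<le> 1\<close>, the gap bound just obtained dominates the
    claimed one.\<close>
  moreover have "\<delta> * B ^ \<Delta> / (real q * real CARD('v)) \<le> 1 * B ^ \<Delta> / (real q * real CARD('v))"
    using \<delta> assms by (intro divide_right_mono mult_right_mono) auto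
  ultimately show ?thesis by simp
qed

end
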